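(* Let $m\ge 2$, $n\ge 1$, $d\ge 1$ be integers and let $\mathbb{T}=(t_{i_1i_2\cdots i_m})$ be a tensor of order $m$ and dimension $n$ over $\mathbb{C}$. Then $$Tr_d(\mathbb{T})=(m-1)^{n-1}\sum_{F\in\mathcal{F}_d}\frac{b(F)}{c(F)}\,\pi_F(\mathbb{T})\,|\mathbf{W}(F)|,$$ where $b(F)$, $c(F)$ and $|\mathbf{W}(F)|$ depend only on the arc multi-set $E(F)$ and are independent of the tensor $\mathbb{T}$.
   Context: Write $[n]=\{1,\dots,n\}$. A tensor $\mathbb{T}$ of order $m$ and dimension $n$ is an array of complex entries $t_{i_1\cdots i_m}$, $i_1,\dots,i_m\in[n]$; write $t_{i\alpha}=t_{ii_2\cdots i_m}$ for $\alpha=(i_2,\dots,i_m)\in[n]^{m-1}$. Trace: let $A=(a_{ij})$ be an $n\times n$ matrix whose entries are independent variables, and for $\alpha=(s_1,\dots,s_{m-1})\in[n]^{m-1}$ put $\frac{\partial}{\partial a_{i\alpha}}=\prod_{k=1}^{m-1}\frac{\partial}{\partial a_{is_k}}$. The $d$-th order trace is $$Tr_d(\mathbb{T})=(m-1)^{n-1}\sum_{d_1+\cdots+d_n=d}\ \prod_{i=1}^n\frac{1}{(d_i(m-1))!}\Big(\sum_{y_i\in[n]^{m-1}}t_{iy_i}\frac{\partial}{\partial a_{iy_i}}\Big)^{d_i}\operatorname{tr}(A^{d(m-1)}),$$ the sum being over nonnegative integers $d_1,\dots,d_n$ with sum $d$. $\mathcal{F}_d=\{((i_1,\alpha_1),\dots,(i_d,\alpha_d))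 : 1\le i_1\le\cdots\le i_d\le n,\ \alpha_1,\dots,\alpha_d\in[n]^{m-1}\}$. For $F=((i_1,\alpha_1),\dots,(i_d,\alpha_d))\in\mathcal{F}_d$ put $\pi_F(\mathbb{T})=\prod_{j=1}^d t_{i_j\alpha_j}$. An arc multi-set is a multi-set of elements (arcs) of $[n]\times[n]$ (loops $(i,i)$ allowed). For $F\in\mathcal{F}_d$, $E(F)$ is the arc multi-set obtained as the multi-set union (multiplicities added) over $j=1,\dots,d$ of $\{(i_j,v_1),\dots,(i_j,v_{m-1})\}$, where $\alpha_j=(v_1,\dots,v_{m-1})$. $b(F)$ is the product of the factorials of the multiplicities of all the distinct arcs of $E(F)$; $c(F)$ is the product over all $i\in[n]$ of the factorial of the outdegree of $i$ in $E(F)$ (the number, with multiplicity, of arcs with initial vertex $i$). A closed walk of length $r$ is a sequence $(v_1,\dots,v_r)\in[n]^r$ (so the initial vertex is part of the data); its arc multi-set is $\{(v_1,v_2),(v_2,v_3),\dots,(v_r,v_1)\}$ with multiplicities. $\mathbf{W}(F)$ is the set of all closed walks whose arc multi-set equals $E(F)$. *)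

theory Defs
  imports
    "HOL-Library.Poly_Mapping"
    "HOL-Library.FuncSet"
    "HOL-Library.Multiset"
    "Jordan_Normal_Form.Matrix"
begin

text \<open>
  A polynomial maps monomials (exponent functions of finite support on the variables) to
  coefficients. The variable indexed by \<open>(i, j)\<close> is the matrix entry \<open>a\<^sub>i\<^sub>j\<close>.
\<close>

type_synonym monomial = "(nat \<times> nat) \<Rightarrow>\<^sub>0 nat"
type_synonym mpoly = "monomial \<Rightarrow>\<^sub>0 complex"

definition Const :: "complex \<Rightarrow> mpoly" where
  "Const c = Poly_Mapping.single 0 c"

definition Var :: "nat \<times> nat \<Rightarrow> mpoly" where
  "Var x = Poly_Mapping.single (Poly_Mapping.single x 1) 1"

text \<open>
  Monomials not containing \<open>x\<close> are annihilated by the coefficient \<open>lookup \<mu> x = 0\<close>, so the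
  truncated subtraction of exponents is harmless.
\<close>

definition partial_deriv :: "nat \<times> nat \<Rightarrow> mpoly \<Rightarrow> mpoly" where
  "partial_deriv x p =
    (\<Sum>\<mu> \<in> Poly_Mapping.keys p.
       Poly_Mapping.single (\<mu> - Poly_Mapping.single x 1)
         (of_nat (Poly_Mapping.lookup \<mu> x) * Poly_Mapping.lookup p \<mu>))"

definition partial_derivs :: "nat \<Rightarrow> nat list \<Rightarrow> mpoly \<Rightarrow> mpoly" where
  "partial_derivs i \<alpha> = foldr (\<lambda>s. partial_deriv (i, s)) \<alpha>"

text \<open>Vertices and tensor indices are \<open>1, \<dots>, n\<close>, whereas matrices are indexed from \<open>0\<close>.\<close>

definition generic_mat :: "nat \<Rightarrow> mpoly mat" where
  "generic_mat n = mat n n (\<lambda>(i, j). Var (Suc i, Suc j))"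

definition mat_trace :: "'a :: comm_monoid_add mat \<Rightarrow> 'a" where
  "mat_trace A = (\<Sum>i<dim_row A. A $$ (i, i))"

text \<open>
  A tensor of order \<open>m\<close> and dimension \<open>n\<close> is a function on index lists, of which only the values
  on \<open>multi_indices n m\<close> are ever used; \<open>T (i # \<alpha>)\<close> is the entry \<open>t\<^sub>i\<^sub>\<alpha>\<close>.
\<close>

type_synonym tensor = "nat list \<Rightarrow> complex"

definition multi_indices :: "nat \<Rightarrow> nat \<Rightarrow> nat list set" where
  "multi_indices n k = {\<alpha>. length \<alpha> = k \<and> set \<alpha> \<subseteq> {1..n}}"

definition trace_op :: "nat \<Rightarrow> nat \<Rightarrow> tensor \<Rightarrow> nat \<Rightarrow> mpoly \<Rightarrow> mpoly" where
  "trace_op m n T i p =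
    (\<Sum>y \<in> multi_indices n (m - 1). Const (T (i # y)) * partial_derivs i y p)"

definition weak_compositions :: "nat \<Rightarrow> nat \<Rightarrow> (nat \<Rightarrow> nat) set" where
  "weak_compositions n d = {\<delta> \<in> {1..n} \<rightarrow>\<^sub>E UNIV. (\<Sum>i\<in>{1..n}. \<delta> i) = d}"

text \<open>
  The product over \<open>i\<close> is a product, that is, a composition, of differential operators applied to
  the trace of the matrix power; the operators commute, so their order is immaterial.
  The result is an element of the polynomial ring.
\<close>

definition Tr :: "nat \<Rightarrow> nat \<Rightarrow> nat \<Rightarrow> tensor \<Rightarrow> mpoly" where
  "Tr m n d T =
    Const (of_nat (m - 1) ^ (n - 1)) *
    (\<Sum>\<delta> \<in> weak_compositions n d.
       foldr (\<lambda>i p. Const (1 / fact (\<delta> i * (m - 1))) * (trace_op m n T i ^^ \<delta> i) p)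
         [1..<Suc n] (mat_trace (generic_mat n ^\<^sub>m (d * (m - 1)))))"

definition index_seqs :: "nat \<Rightarrow> nat \<Rightarrow> nat \<Rightarrow> (nat \<times> nat list) list set" where
  "index_seqs m n d =
    {F. length F = d \<and> sorted (map fst F) \<and> set F \<subseteq> {1..n} \<times> multi_indices n (m - 1)}"

definition entry_prod :: "tensor \<Rightarrow> (nat \<times> nat list) list \<Rightarrow> complex" where
  "entry_prod T F = (\<Prod>(i, \<alpha>)\<leftarrow>F. T (i # \<alpha>))"

definition arcs :: "(nat \<times> nat list) list \<Rightarrow> (nat \<times> nat) multiset" where
  "arcs F = (\<Sum>(i, \<alpha>)\<leftarrow>F. mset (map (\<lambda>v. (i, v)) \<alpha>))"

definition arc_fact :: "(nat \<times> nat list) list \<Rightarrow> nat" where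
  "arc_fact F = (\<Prod>e \<in> set_mset (arcs F). fact (count (arcs F) e))"

definition outdegree :: "(nat \<times> nat) multiset \<Rightarrow> nat \<Rightarrow> nat" where
  "outdegree E i = size {#e \<in># E. fst e = i#}"

definition outdegree_fact :: "nat \<Rightarrow> (nat \<times> nat list) list \<Rightarrow> nat" where
  "outdegree_fact n F = (\<Prod>i\<in>{1..n}. fact (outdegree (arcs F) i))"

definition walk_arcs :: "nat list \<Rightarrow> (nat \<times> nat) multiset" where
  "walk_arcs w = mset (zip w (rotate1 w))"

definition closed_walks :: "nat \<Rightarrow> (nat \<times> nat list) list \<Rightarrow> nat list set" where
  "closed_walks n F = {w. w \<noteq> [] \<and> set w \<subseteq> {1..n} \<and> walk_arcs w = arcs F}"

lemma finite_multi_indices: "finite (multi_indices n k)"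
proof -
  have "multi_indices n k = {\<alpha>. set \<alpha> \<subseteq> {1..n} \<and> length \<alpha> = k}"
    by (auto simp: multi_indices_def)
  then show ?thesis by (simp add: finite_lists_length_eq)
qed

lemma finite_weak_compositions: "finite (weak_compositions n d)"
proof (rule finite_subset)
  show "weak_compositions n d \<subseteq> {1..n} \<rightarrow>\<^sub>E {..d}"
    unfolding weak_compositions_def
    by (auto simp: PiE_iff extensional_def intro!: member_le_sum)
  show "finite ({1..n} \<rightarrow>\<^sub>E {..d})" by (intro finite_PiE) auto
qed

lemma finite_index_seqs: "finite (index_seqs m n d)"
proof (rule finite_subset)
  show "index_seqs m n d \<subseteq> {F. set F \<subseteq> {1..n} \<times> multi_indices n (m - 1) \<and> length F = d}"
    by (auto simp: index_seqs_def)
  show "finite {F. set F \<subseteq> {1..n} \<times> multi_indices n (m - 1) \<and> length F = d}"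
    by (intro finite_lists_length_eq finite_cartesian_product finite_multi_indices) auto
qed

lemma finite_closed_walks: "finite (closed_walks n F)"
proof (rule finite_subset)
  have "length w = size (arcs F)" if "walk_arcs w = arcs F" for w
    using arg_cong[OF that, of size] by (simp add: walk_arcs_def)
  then show "closed_walks n F \<subseteq> {w. set w \<subseteq> {1..n} \<and> length w = size (arcs F)}"
    unfolding closed_walks_def by blast
  show "finite {w. set w \<subseteq> {1..n} \<and> length w = size (arcs F)}"
    by (intro finite_lists_length_eq) auto
qed

end

theory Submission
  imports Defs
begin

text \<open>
  The trace of \<open>A ^ r\<close> is the sum, over all closed walks of length \<open>r\<close>, of the monomials given by
  their arc multi-sets. Expanding the powers of the differential operators yields one composite
  derivative for each \<open>F\<close>, namely along the arcs of \<open>E(F)\<close>; the composition \<open>\<delta>\<close> is recovered from \<open>F\<close>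
  as the number of entries of \<open>F\<close> with a given first index, and \<open>\<delta> i * (m - 1)\<close> is the outdegree of
  \<open>i\<close>. That derivative has order \<open>d * (m - 1)\<close>, the degree of \<open>tr (A ^ (d * (m - 1)))\<close>, so it
  annihilates every monomial except the one with arc multi-set \<open>E(F)\<close>, which it sends to \<open>b(F)\<close>.
\<close>

section \<open>Monomials of arc multi-sets and constant polynomials\<close>

text \<open>Turns multiplicities of arcs into exponents, so that differentiating a monomial becomes
  removing an arc.\<close>

definition mset_monomial :: "(nat \<times> nat) multiset \<Rightarrow> monomial" where
  "mset_monomial M = (\<Sum>e\<in>#M. Poly_Mapping.single e 1)"

lemma mset_monomial_empty [simp]: "mset_monomial {#} = 0"
  by (simp add: mset_monomial_def)

lemma mset_monomial_add_mset [simp]: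
  "mset_monomial (add_mset e M) = Poly_Mapping.single e 1 + mset_monomial M"
  by (simp add: mset_monomial_def)

lemma lookup_mset_monomial: "Poly_Mapping.lookup (mset_monomial M) e = count M e"
  by (induction M) (auto simp: lookup_add lookup_single)

lemma Const_mult: "Const a * Const b = Const (a * b)"
  by (simp add: Const_def mult_single)

lemma Const_0 [simp]: "Const 0 = 0"
  by (simp add: Const_def)

lemma Const_1 [simp]: "Const 1 = 1"
  by (simp add: Const_def)

lemma Const_add: "Const (a + b) = Const a + Const b"
  by (simp add: Const_def single_add)

lemma Const_sum: "Const (sum f A) = (\<Sum>x\<in>A. Const (f x))"
  by (induction A rule: infinite_finite_induct) (auto simp: Const_add)

lemma lookup_Const_mult:
  "Poly_Mapping.lookup (Const c * p) \<nu> = c * Poly_Mapping.lookup p \<nu>"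
  unfolding Const_def mult_map_scale_conv_mult [symmetric]
  by (simp add: Poly_Mapping.map.rep_eq when_def)

section \<open>Linear operators on polynomials\<close>

text \<open>Homogeneity is phrased with constant polynomials because scalars enter
  \<open>trace_op\<close> and \<open>Tr\<close> in this form.\<close>

definition linear_op :: "(mpoly \<Rightarrow> mpoly) \<Rightarrow> bool" where
  "linear_op L \<longleftrightarrow> (\<forall>p q. L (p + q) = L p + L q) \<and> (\<forall>c p. L (Const c * p) = Const c * L p)"

lemma linear_op_add: "linear_op L \<Longrightarrow> L (p + q) = L p + L q"
  by (simp add: linear_op_def)

lemma linear_op_Const_mult: "linear_op L \<Longrightarrow> L (Const c * p) = Const c * L p"
  by (simp add: linear_op_def)

lemma linear_op_zero: "linear_op L \<Longrightarrow> L 0 = 0"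
  using linear_op_Const_mult [of L 0 0] by simp

lemma linear_op_sum: "linear_op L \<Longrightarrow> L (sum f A) = (\<Sum>x\<in>A. L (f x))"
  by (induction A rule: infinite_finite_induct) (auto simp: linear_op_zero linear_op_add)

lemma linear_op_foldr:
  "(\<And>x. x \<in> set xs \<Longrightarrow> linear_op (f x)) \<Longrightarrow> linear_op (foldr f xs)"
  by (induction xs) (auto simp: linear_op_def)

section \<open>Partial derivatives of monomials\<close>

text \<open>Only one monomial of \<open>p\<close> can be lowered to \<nu>. Unlike the defining sum,
  whose range depends on \<open>p\<close>, this coefficient formula makes linearity
  immediate.\<close>

lemma lookup_partial_deriv:
  "Poly_Mapping.lookup (partial_deriv x p) \<nu> =
    of_nat (Suc (Poly_Mapping.lookup \<nu> x)) *
      Poly_Mapping.lookup p (\<nu> + Poly_Mapping.single x 1)"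
proof -
  let ?s = "Poly_Mapping.single x (1::nat)"
  \<comment> \<open>Truncated subtraction can be undone only where \<open>x\<close> occurs in \<mu>;
    the other monomials enter the sum with factor 0.\<close>
  have shift: "\<mu> = \<nu> + ?s" if "\<mu> - ?s = \<nu>" "Poly_Mapping.lookup \<mu> x \<noteq> 0" for \<mu>
  proof (rule poly_mapping_eqI)
    fix k
    show "Poly_Mapping.lookup \<mu> k = Poly_Mapping.lookup (\<nu> + ?s) k"
      using that by (auto simp: lookup_add lookup_minus lookup_single when_def)
  qed
  have "Poly_Mapping.lookup (partial_deriv x p) \<nu> =
      (\<Sum>\<mu> \<in> Poly_Mapping.keys p.
         (of_nat (Poly_Mapping.lookup \<mu> x) * Poly_Mapping.lookup p \<mu> when \<mu> - ?s = \<nu>))"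
    by (simp add: partial_deriv_def lookup_sum lookup_single)
  also have "\<dots> = (\<Sum>\<mu> \<in> Poly_Mapping.keys p.
      if \<mu> = \<nu> + ?s then of_nat (Poly_Mapping.lookup \<mu> x) * Poly_Mapping.lookup p \<mu> else 0)"
    using shift by (intro sum.cong) (auto simp: when_def)
  also have "\<dots> = of_nat (Suc (Poly_Mapping.lookup \<nu> x)) * Poly_Mapping.lookup p (\<nu> + ?s)"
    by (auto simp: lookup_add in_keys_iff)
  finally show ?thesis .
qed

lemma linear_op_partial_deriv: "linear_op (partial_deriv x)"
  unfolding linear_op_def
  by (auto intro!: poly_mapping_eqI
      simp: lookup_partial_deriv lookup_add lookup_Const_mult distrib_left mult.left_commute
      simp del: of_nat_Suc)

lemma partial_deriv_single:
  "partial_deriv x (Poly_Mapping.single \<mu> c) =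
    Poly_Mapping.single (\<mu> - Poly_Mapping.single x 1) (of_nat (Poly_Mapping.lookup \<mu> x) * c)"
  by (cases "c = 0") (auto simp: partial_deriv_def)

lemma partial_deriv_mset_monomial:
  "partial_deriv x (Poly_Mapping.single (mset_monomial M) c) =
    Poly_Mapping.single (mset_monomial (M - {#x#})) (of_nat (count M x) * c)"
proof (cases "x \<in># M")
  case True
  then obtain N where "M = add_mset x N"
    by (meson multi_member_split)
  then show ?thesis
    by (simp add: partial_deriv_single lookup_mset_monomial lookup_add)
next
  case False
  then show ?thesis
    by (simp add: partial_deriv_single lookup_mset_monomial not_in_iff)
qed

lemma prod_fact_count_add_mset:
  "(\<Prod>e\<in>set_mset (add_mset x M). fact (count (add_mset x M) e)) =
    Suc (count M x) * (\<Prod>e\<in>set_mset M. fact (count M e) :: nat)"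
proof -
  let ?P = "\<Prod>e\<in>set_mset M - {x}. fact (count M e) :: nat"
  \<comment> \<open>If \<open>x\<close> is not in \<open>M\<close>, inserting it adds the factor
    \<open>fact 0 = 1\<close>, so both cases are handled at once.\<close>
  have "(\<Prod>e\<in>set_mset M. fact (count M e)) =
      (\<Prod>e\<in>insert x (set_mset M). fact (count M e) :: nat)"
    by (intro prod.mono_neutral_left) (auto simp: not_in_iff)
  also have "\<dots> = fact (count M x) * ?P"
    by (simp add: prod.insert_remove)
  finally have M: "(\<Prod>e\<in>set_mset M. fact (count M e)) = fact (count M x) * ?P" .
  have "(\<Prod>e\<in>set_mset M - {x}. fact (count (add_mset x M) e)) = ?P"
    by (intro prod.cong) auto
  then show ?thesis
    by (simp add: M prod.insert_remove algebra_simps)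
qed

text \<open>With equal sizes, \<open>M \<noteq> mset xs\<close> forces some arc to occur in
  \<open>xs\<close> more often than in \<open>M\<close>, and its derivatives annihilate the
  monomial. Otherwise every variable is used up and the falling exponents multiply to
  factorials.\<close>

lemma foldr_partial_deriv_mset_monomial:
  assumes "size M = length xs"
  shows "foldr partial_deriv xs (Poly_Mapping.single (mset_monomial M) c) =
    (if M = mset xs then Const (of_nat (\<Prod>e\<in>set_mset M. fact (count M e)) * c) else 0)"
  using assms
\<comment> \<open>\<open>foldr\<close> applies the derivative at the right end first;
  \<open>c\<close> must vary because it absorbs the exponent brought down.\<close>
proof (induction xs arbitrary: M c rule: rev_induct)
  case Nil
  then show ?case
    by (simp add: Const_def)
next
  case (snoc x xs)
  have z: "foldr partial_deriv xs 0 = 0"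
    by (intro linear_op_zero linear_op_foldr linear_op_partial_deriv)
  show ?case
  proof (cases "x \<in># M")
    case True
    then obtain N where N: "M = add_mset x N"
      by (meson multi_member_split)
    with snoc.prems have size: "size N = length xs"
      by simp
    have deriv: "partial_deriv x (Poly_Mapping.single (mset_monomial M) c) =
        Poly_Mapping.single (mset_monomial N) (of_nat (Suc (count N x)) * c)"
      using partial_deriv_mset_monomial [of x M c] by (simp add: N)
    have fact: "(\<Prod>e\<in>set_mset M. fact (count M e)) =
        Suc (count N x) * (\<Prod>e\<in>set_mset N. fact (count N e))"
      unfolding N by (rule prod_fact_count_add_mset)
    have eq: "M = mset (xs @ [x]) \<longleftrightarrow> N = mset xs"
      by (simp add: N)
    show ?thesis
      unfolding eq fact by (simp add: deriv snoc.IH [OF size] mult_ac del: of_nat_Suc of_nat_prod mult_Suc)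
  next
    case False
    then have "M \<noteq> mset (xs @ [x])"
      by auto
    with False show ?thesis
      by (simp add: partial_deriv_mset_monomial not_in_iff z)
  qed
qed

section \<open>The trace of a matrix power as a sum over closed walks\<close>

lemma multi_indices_0 [simp]: "multi_indices n 0 = {[]}"
  by (auto simp: multi_indices_def)

lemma sum_multi_indices_Suc:
  "(\<Sum>v\<in>multi_indices n (Suc k). f v) = (\<Sum>x\<in>{1..n}. \<Sum>v\<in>multi_indices n k. f (x # v))"
proof -
  have "multi_indices n (Suc k) = (\<lambda>(x, v). x # v) ` ({1..n} \<times> multi_indices n k)"
    by (fastforce simp: multi_indices_def image_iff length_Suc_conv)
  then show ?thesis
    by (simp add: sum.reindex inj_on_def sum.cartesian_product split_def)
qed

text \<open>\<open>pow_mat\<close> multiplies on the right, whereas a walk stored as a list is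
  extended at its front.\<close>

lemma pow_mat_Suc_left:
  fixes A :: "'a :: semiring_1 mat"
  assumes "A \<in> carrier_mat n n"
  shows "A ^\<^sub>m Suc k = A * A ^\<^sub>m k"
proof (induction k)
  case 0
  then show ?case
    using assms by simp
next
  case (Suc k)
  have "A ^\<^sub>m Suc (Suc k) = (A * A ^\<^sub>m k) * A"
    using Suc by simp
  also have "\<dots> = A * (A ^\<^sub>m k * A)"
    using assms by (intro assoc_mult_mat [of _ n n _ n _ n]) auto
  finally show ?case
    by simp
qed

text \<open>Here \<open>v\<close> lists the vertices after the start \<open>Suc i\<close>, and the
  zip pairs each vertex with its successor. Putting the start inside \<open>last\<close> makes
  \<open>k = 0\<close> yield the identity matrix. The induction splits off the first arc.\<close>

lemma generic_mat_pow_index: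
  assumes "i < n" "j < n"
  shows "(generic_mat n ^\<^sub>m k) $$ (i, j) =
    (\<Sum>v\<in>multi_indices n k.
       if last (Suc i # v) = Suc j
       then Poly_Mapping.single (mset_monomial (mset (zip (Suc i # v) v))) 1 else 0)"
  using assms
proof (induction k arbitrary: i)
  case 0
  then show ?case
    by (simp add: generic_mat_def)
next
  case (Suc k)
  let ?w = "\<lambda>u v. Poly_Mapping.single (mset_monomial (mset (zip (u # v) v))) (1 :: complex)"
  have A: "generic_mat n \<in> carrier_mat n n"
    by (simp add: generic_mat_def)
  have entry: "generic_mat n $$ (i, l) =
      Poly_Mapping.single (Poly_Mapping.single (Suc i, Suc l) 1) 1"
    if "l < n" for l
    using that Suc.prems by (simp add: generic_mat_def Var_def)
  have "(generic_mat n ^\<^sub>m Suc k) $$ (i, j) =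
      (\<Sum>l<n. generic_mat n $$ (i, l) * (generic_mat n ^\<^sub>m k) $$ (l, j))"
    using Suc.prems A pow_carrier_mat [OF A, of k]
    by (simp add: pow_mat_Suc_left [OF A] scalar_prod_def lessThan_atLeast0 del: pow_mat.simps)
  also have "\<dots> = (\<Sum>l<n. \<Sum>v\<in>multi_indices n k.
      if last (Suc l # v) = Suc j then ?w (Suc i) (Suc l # v) else 0)"
    using Suc.prems
    by (intro sum.cong refl)
       (auto simp: Suc.IH entry sum_distrib_left mult_single intro!: sum.cong)
  also have "\<dots> = (\<Sum>x\<in>{1..n}. \<Sum>v\<in>multi_indices n k.
      if last (x # v) = Suc j then ?w (Suc i) (x # v) else 0)"
    by (intro sum.reindex_bij_witness [of _ "\<lambda>x. x - 1" Suc]) auto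
  also have "\<dots> = (\<Sum>v\<in>multi_indices n (Suc k).
      if last (Suc i # v) = Suc j then ?w (Suc i) v else 0)"
    unfolding sum_multi_indices_Suc by (intro sum.cong refl) simp
  finally show ?case .
qed

text \<open>A diagonal entry collects the walks that return to their start. For \<open>k = 0\<close>
  the trace is \<open>n\<close>, while the right-hand side is 1.\<close>

lemma mat_trace_generic_mat_pow:
  assumes "k > 0"
  shows "mat_trace (generic_mat n ^\<^sub>m k) =
    (\<Sum>w\<in>multi_indices n k. Poly_Mapping.single (mset_monomial (walk_arcs w)) 1)"
proof -
  let ?w = "\<lambda>u v. Poly_Mapping.single (mset_monomial (mset (zip (u # v) v))) (1 :: complex)"
  have last: "v \<noteq> []" "last v \<in> {1..n}" if "v \<in> multi_indices n k" for v
  proof -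
    show "v \<noteq> []"
      using that assms by (auto simp: multi_indices_def)
    then show "last v \<in> {1..n}"
      using that last_in_set [of v] unfolding multi_indices_def by blast
  qed
  have "mat_trace (generic_mat n ^\<^sub>m k) = (\<Sum>i<n. (generic_mat n ^\<^sub>m k) $$ (i, i))"
    by (simp add: mat_trace_def generic_mat_def)
  also have "\<dots> = (\<Sum>i<n. \<Sum>v\<in>multi_indices n k. if last v = Suc i then ?w (Suc i) v else 0)"
    by (intro sum.cong refl) (auto simp: generic_mat_pow_index last intro!: sum.cong)
  also have "\<dots> = (\<Sum>x\<in>{1..n}. \<Sum>v\<in>multi_indices n k. if last v = x then ?w x v else 0)"
    by (intro sum.reindex_bij_witness [of _ "\<lambda>x. x - 1" Suc]) auto
  also have "\<dots> = (\<Sum>v\<in>multi_indices n k. \<Sum>x\<in>{1..n}. if last v = x then ?w x v else 0)"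
    by (rule sum.swap)
  \<comment> \<open>A closed walk ends where it starts, so \<open>x\<close> is forced to be
    \<open>last v\<close>.\<close>
  also have "\<dots> = (\<Sum>v\<in>multi_indices n k. ?w (last v) v)"
    using last by (intro sum.cong refl) simp
  \<comment> \<open>The list \<open>v\<close> begins one step after the start, whereas
    \<open>walk_arcs\<close> expects the start first; hence \<open>v = rotate1 w\<close>.\<close>
  also have "\<dots> = (\<Sum>w\<in>multi_indices n k. ?w (last (rotate1 w)) (rotate1 w))"
  proof (rule sum.reindex_bij_betw [symmetric])
    have "\<exists>w\<in>multi_indices n k. v = rotate1 w" if v: "v \<in> multi_indices n k" for v
    proof -
      obtain w where "v = rotate1 w"
        using surj_rotate1 by (metis surjD)
      with v show ?thesis
        by (auto simp: multi_indices_def)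
    qed
    then have "multi_indices n k \<subseteq> rotate1 ` multi_indices n k"
      by blast
    moreover have "rotate1 ` multi_indices n k \<subseteq> multi_indices n k"
      by (auto simp: multi_indices_def)
    ultimately show "bij_betw rotate1 (multi_indices n k) (multi_indices n k)"
      by (intro bij_betw_imageI inj_on_subset [OF inj_rotate1]) auto
  qed
  also have "\<dots> = (\<Sum>w\<in>multi_indices n k. Poly_Mapping.single (mset_monomial (walk_arcs w)) 1)"
  proof (rule sum.cong [OF refl])
    fix w
    assume "w \<in> multi_indices n k"
    then obtain a u where w: "w = a # u"
      using last(1) by (metis list.exhaust)
    \<comment> \<open>The left list is longer by one; its surplus final \<open>a\<close> is dropped
      by the zip.\<close>
    have "zip ((a # u) @ [a]) ((u @ [a]) @ []) = zip (a # u) (u @ [a])"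
      by (subst zip_append) auto
    then show "?w (last (rotate1 w)) (rotate1 w) =
        Poly_Mapping.single (mset_monomial (walk_arcs w)) 1"
      by (simp add: w walk_arcs_def)
  qed
  finally show ?thesis .
qed

section \<open>Differentiating the trace along the arcs of one index sequence\<close>

text \<open>Fixes an order on \<open>arcs F\<close>, namely the one in which the nested operators
  produce their derivatives.\<close>

definition arc_list :: "(nat \<times> nat list) list \<Rightarrow> (nat \<times> nat) list" where
  "arc_list F = concat (map (\<lambda>(i, \<alpha>). map (Pair i) \<alpha>) F)"

lemma mset_arc_list: "mset (arc_list F) = arcs F"
  by (induction F) (auto simp: arc_list_def arcs_def)

text \<open>The number of derivatives equals the degree of the trace, so each walk in
  \<open>closed_walks n F\<close> contributes \<open>arc_fact F\<close> and every other walk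
  contributes 0.\<close>

lemma foldr_partial_deriv_mat_trace:
  assumes "size (arcs F) > 0"
  shows "foldr partial_deriv (arc_list F) (mat_trace (generic_mat n ^\<^sub>m size (arcs F))) =
    Const (of_nat (arc_fact F) * of_nat (card (closed_walks n F)))"
proof -
  let ?k = "size (arcs F)"
  have len: "length (arc_list F) = ?k"
    by (metis mset_arc_list size_mset)
  have walk: "length w = ?k" if "walk_arcs w = arcs F" for w
    using arg_cong [OF that, of size] by (simp add: walk_arcs_def)
  \<comment> \<open>Equality of arc multi-sets fixes the length of the walk; positivity excludes the
    empty list.\<close>
  have cw: "closed_walks n F = {w \<in> multi_indices n ?k. walk_arcs w = arcs F}"
    using assms by (auto simp: closed_walks_def multi_indices_def walk)
  have "foldr partial_deriv (arc_list F) (mat_trace (generic_mat n ^\<^sub>m ?k)) =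
      (\<Sum>w\<in>multi_indices n ?k. foldr partial_deriv (arc_list F)
         (Poly_Mapping.single (mset_monomial (walk_arcs w)) 1))"
    using assms
    by (simp add: mat_trace_generic_mat_pow linear_op_sum linear_op_foldr linear_op_partial_deriv)
  also have "\<dots> = (\<Sum>w\<in>multi_indices n ?k.
      if walk_arcs w = arcs F then Const (of_nat (arc_fact F)) else 0)"
    by (intro sum.cong refl, subst foldr_partial_deriv_mset_monomial)
       (auto simp: mset_arc_list len arc_fact_def walk_arcs_def multi_indices_def)
  also have "\<dots> = (\<Sum>w\<in>closed_walks n F. Const (of_nat (arc_fact F)))"
    by (simp add: cw sum.If_cases finite_multi_indices Int_def)
  also have "\<dots> = Const (of_nat (arc_fact F) * of_nat (card (closed_walks n F)))"
    unfolding Const_sum [symmetric] by (simp add: mult.commute)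
  finally show ?thesis .
qed

section \<open>Expansion of the powers of the operators\<close>

definition labelled_seqs :: "nat \<Rightarrow> nat \<Rightarrow> nat list \<Rightarrow> (nat \<times> nat list) list set" where
  "labelled_seqs m n is = {F. map fst F = is \<and> snd ` set F \<subseteq> multi_indices n (m - 1)}"

lemma linear_op_trace_op: "linear_op (trace_op m n T i)"
proof -
  have "linear_op (partial_derivs i y)" for y
    unfolding partial_derivs_def by (intro linear_op_foldr linear_op_partial_deriv)
  then show ?thesis
    unfolding linear_op_def trace_op_def
    by (auto simp: sum.distrib sum_distrib_left algebra_simps intro!: sum.cong)
qed

text \<open>Distributivity: expanding the composition chooses one \<open>y\<close> for each position
  of \<open>is\<close>, and linearity moves the tensor entries to the front.\<close>

lemma foldr_trace_op:
  "foldr (trace_op m n T) is p =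
    (\<Sum>F\<in>labelled_seqs m n is. Const (entry_prod T F) * foldr partial_deriv (arc_list F) p)"
proof (induction "is")
  case Nil
  have "labelled_seqs m n [] = {[]}"
    by (auto simp: labelled_seqs_def)
  then show ?case
    by (simp add: entry_prod_def arc_list_def)
next
  case (Cons i "is")
  let ?D = "\<lambda>F. foldr partial_deriv (arc_list F) p"
  have lin: "linear_op (foldr partial_deriv xs)" for xs
    by (intro linear_op_foldr linear_op_partial_deriv)
  have pd: "partial_derivs i y q = foldr partial_deriv (map (Pair i) y) q" for y q
    by (simp add: partial_derivs_def foldr_map comp_def)
  have set: "labelled_seqs m n (i # is) =
      (\<lambda>(y, F). (i, y) # F) ` (multi_indices n (m - 1) \<times> labelled_seqs m n is)"
    by (fastforce simp: labelled_seqs_def map_eq_Cons_conv image_iff)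
  have "foldr (trace_op m n T) (i # is) p =
      trace_op m n T i (\<Sum>F\<in>labelled_seqs m n is. Const (entry_prod T F) * ?D F)"
    by (simp add: Cons)
  also have "\<dots> = (\<Sum>y\<in>multi_indices n (m - 1). \<Sum>F\<in>labelled_seqs m n is.
      Const (entry_prod T ((i, y) # F)) * ?D ((i, y) # F))"
    unfolding trace_op_def
    by (intro sum.cong refl)
       (simp add: linear_op_sum [OF lin] linear_op_Const_mult [OF lin] sum_distrib_left pd
         entry_prod_def arc_list_def Const_mult [symmetric] mult.assoc)
  also have "\<dots> = (\<Sum>F\<in>labelled_seqs m n (i # is). Const (entry_prod T F) * ?D F)"
    unfolding set by (simp add: sum.reindex inj_on_def sum.cartesian_product split_def)
  finally show ?case .
qed

text \<open>Linearity collects the scalars in front, and each power is unrolled into a block of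
  equal indices, which brings \<open>foldr_trace_op\<close> into play.\<close>

lemma foldr_weighted_trace_op:
  "foldr (\<lambda>i p. Const (c i) * (trace_op m n T i ^^ \<delta> i) p) is p =
    Const (\<Prod>i\<leftarrow>is. c i) * foldr (trace_op m n T) (concat (map (\<lambda>i. replicate (\<delta> i) i) is)) p"
proof (induction "is")
  case Nil
  then show ?case
    by simp
next
  case (Cons i "is")
  have "linear_op (foldr (trace_op m n T) (replicate (\<delta> i) i))"
    by (intro linear_op_foldr linear_op_trace_op)
  then have "linear_op (trace_op m n T i ^^ \<delta> i)"
    by (simp add: linear_op_def)
  then show ?case
    by (simp add: Cons linear_op_Const_mult Const_mult [symmetric] mult.assoc)
qed

section \<open>Index sequences grouped by weak compositions\<close>

lemma count_list_concat_replicate: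
  "distinct is \<Longrightarrow>
    count_list (concat (map (\<lambda>i. replicate (\<delta> i) i) is)) j = (if j \<in> set is then \<delta> j else 0)"
proof (induction "is")
  case (Cons i "is")
  have "count_list (replicate k i) j = (if i = j then k else 0)" for k
    by (induction k) auto
  with Cons show ?case
    by auto
qed simp

lemma sorted_concat_replicate:
  "sorted is \<Longrightarrow> sorted (concat (map (\<lambda>i. replicate (\<delta> i) i) is))"
  by (induction "is") (auto simp: sorted_append split: if_splits)

text \<open>Each entry of \<open>F\<close> with first index \<open>i\<close> contributes exactly
  \<open>k\<close> arcs, all leaving \<open>i\<close>.\<close>

lemma outdegree_arcs:
  assumes "snd ` set F \<subseteq> multi_indices n k"
  shows "outdegree (arcs F) i = count_list (map fst F) i * k"
  using assms
proof (induction F)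
  case (Cons x F)
  obtain j \<alpha> where x: "x = (j, \<alpha>)"
    by fastforce
  have "size {#e \<in># mset (map (Pair j) \<alpha>). fst e = i#} = (if j = i then length \<alpha> else 0)"
    by (induction \<alpha>) auto
  with Cons show ?case
    by (auto simp: x outdegree_def arcs_def multi_indices_def)
qed (simp add: outdegree_def arcs_def)

lemma size_arcs:
  "snd ` set F \<subseteq> multi_indices n k \<Longrightarrow> size (arcs F) = length F * k"
  by (induction F) (auto simp: arcs_def multi_indices_def)

text \<open>The restriction places the counts in the extensional function space underlying
  \<open>weak_compositions\<close>.\<close>

definition row_counts :: "nat \<Rightarrow> (nat \<times> nat list) list \<Rightarrow> nat \<Rightarrow> nat" where
  "row_counts n F = restrict (count_list (map fst F)) {1..n}"

abbreviation row_list :: "nat \<Rightarrow> (nat \<Rightarrow> nat) \<Rightarrow> nat list" where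
  "row_list n \<delta> \<equiv> concat (map (\<lambda>i. replicate (\<delta> i) i) [1..<Suc n])"

lemma row_counts_in_weak_compositions:
  assumes "F \<in> index_seqs m n d"
  shows "row_counts n F \<in> weak_compositions n d"
proof -
  have "(\<Sum>i\<in>{1..n}. count_list (map fst F) i) = d"
    using assms sum_count_set [of "map fst F" "{1..n}"] by (fastforce simp: index_seqs_def)
  then show ?thesis
    by (simp add: weak_compositions_def row_counts_def)
qed

text \<open>A sorted list is determined by its multiplicities, so \<delta> prescribes the first
  components of \<open>F\<close> completely, while the second components remain free.\<close>

lemma index_seqs_row_counts:
  assumes "\<delta> \<in> weak_compositions n d"
  shows "{F \<in> index_seqs m n d. row_counts n F = \<delta>} = labelled_seqs m n (row_list n \<delta>)"
proof (intro equalityI subsetI)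
  fix F
  assume F: "F \<in> {F \<in> index_seqs m n d. row_counts n F = \<delta>}"
  then have sub: "fst ` set F \<subseteq> {1..n}"
    by (auto simp: index_seqs_def)
  \<comment> \<open>Outside \<open>{1..n}\<close> the count is 0 although \<delta> is
    \<open>undefined\<close> there.\<close>
  have "count_list (map fst F) j = (if j \<in> {1..n} then \<delta> j else 0)" for j
    using F sub by (cases "j \<in> fst ` set F") (auto simp: row_counts_def)
  then have "mset (map fst F) = mset (row_list n \<delta>)"
    unfolding multiset_eq_iff count_mset by (auto simp: count_list_concat_replicate simp del: upt_Suc)
  moreover have "sorted (map fst F)" "sorted (row_list n \<delta>)"
    using F by (auto simp: index_seqs_def intro!: sorted_concat_replicate simp del: upt_Suc)
  ultimately have "map fst F = row_list n \<delta>"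
    using properties_for_sort sorted_sort_id by metis
  then show "F \<in> labelled_seqs m n (row_list n \<delta>)"
    using F by (auto simp: labelled_seqs_def index_seqs_def)
next
  fix F
  assume F: "F \<in> labelled_seqs m n (row_list n \<delta>)"
  then have fst: "map fst F = row_list n \<delta>"
    by (simp add: labelled_seqs_def)
  have "row_counts n F = \<delta>"
  proof
    fix i
    \<comment> \<open>Outside \<open>{1..n}\<close> both sides are \<open>undefined\<close>.\<close>
    show "row_counts n F i = \<delta> i"
      using assms unfolding row_counts_def fst
      by (cases "i \<in> {1..n}")
         (auto simp: count_list_concat_replicate weak_compositions_def PiE_def extensional_def
           simp del: upt_Suc)
  qed
  moreover have "fst ` set F \<subseteq> {1..n}"
    using arg_cong [OF fst, of set] by (auto simp del: upt_Suc)
  moreover have "length F = d"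
  proof -
    have "length F = length (row_list n \<delta>)"
      by (metis fst length_map)
    also have "\<dots> = (\<Sum>i\<in>{1..n}. \<delta> i)"
      by (simp add: length_concat comp_def sum_list_distinct_conv_sum_set
          atLeastLessThanSuc_atLeastAtMost del: upt_Suc)
    finally show ?thesis
      using assms by (simp add: weak_compositions_def)
  qed
  moreover have "sorted (map fst F)"
    unfolding fst by (intro sorted_concat_replicate) (simp del: upt_Suc)
  ultimately show "F \<in> {F \<in> index_seqs m n d. row_counts n F = \<delta>}"
    using F by (fastforce simp: index_seqs_def labelled_seqs_def)
qed

section \<open>The trace formula\<close>

theorem theorem2p1:
  fixes m n d :: nat and T :: tensor
  assumes "m \<ge> 2" and "n \<ge> 1" and "d \<ge> 1"
  shows "Tr m n d T =
      Const (of_nat (m - 1) ^ (n - 1) *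
        (\<Sum>F \<in> index_seqs m n d.
           of_nat (arc_fact F) / of_nat (outdegree_fact n F)
             * entry_prod T F * of_nat (card (closed_walks n F))))
    \<and> (\<forall>F \<in> index_seqs m n d. \<forall>F' \<in> index_seqs m n d. arcs F = arcs F' \<longrightarrow>
        arc_fact F = arc_fact F' \<and> outdegree_fact n F = outdegree_fact n F'
          \<and> card (closed_walks n F) = card (closed_walks n F'))"
proof (intro conjI)
  let ?p = "mat_trace (generic_mat n ^\<^sub>m (d * (m - 1)))"
  let ?term = "\<lambda>F. of_nat (arc_fact F) / of_nat (outdegree_fact n F)
    * entry_prod T F * of_nat (card (closed_walks n F)) :: complex"
  have "foldr (\<lambda>i p. Const (1 / fact (\<delta> i * (m - 1))) * (trace_op m n T i ^^ \<delta> i) p)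
      [1..<Suc n] ?p = (\<Sum>F\<in>{F \<in> index_seqs m n d. row_counts n F = \<delta>}. Const (?term F))"
    if \<delta>: "\<delta> \<in> weak_compositions n d" for \<delta>
    unfolding foldr_weighted_trace_op foldr_trace_op sum_distrib_left
      index_seqs_row_counts [OF \<delta>, symmetric]
  proof (rule sum.cong [OF refl])
    fix F
    assume "F \<in> {F \<in> index_seqs m n d. row_counts n F = \<delta>}"
    then have F: "F \<in> index_seqs m n d" "row_counts n F = \<delta>"
      by auto
    have snd: "snd ` set F \<subseteq> multi_indices n (m - 1)"
      using F(1) by (auto simp: index_seqs_def)
    have size: "size (arcs F) = d * (m - 1)"
      using size_arcs [OF snd] F(1) by (simp add: index_seqs_def)
    \<comment> \<open>The denominators in \<open>Tr\<close> depend only on \<delta>; on its fibre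
      they multiply to \<open>outdegree_fact n F\<close>.\<close>
    have "outdegree_fact n F = (\<Prod>i\<in>{1..n}. fact (\<delta> i * (m - 1)))"
      unfolding outdegree_fact_def F(2) [symmetric]
      by (intro prod.cong refl) (simp add: outdegree_arcs [OF snd] row_counts_def)
    then have "(\<Prod>i\<leftarrow>[1..<Suc n]. 1 / fact (\<delta> i * (m - 1))) =
        (1 / of_nat (outdegree_fact n F) :: complex)"
      by (simp add: prod.distinct_set_conv_list [symmetric] atLeastLessThanSuc_atLeastAtMost
          prod_dividef del: upt_Suc)
    \<comment> \<open>The bounds on \<open>m\<close> and \<open>d\<close> make the number of arcs
      \<open>d * (m - 1)\<close> positive.\<close>
    moreover have "foldr partial_deriv (arc_list F) ?p =
        Const (of_nat (arc_fact F) * of_nat (card (closed_walks n F)))"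
      using foldr_partial_deriv_mat_trace [of F n] size assms by simp
    ultimately show "Const (\<Prod>i\<leftarrow>[1..<Suc n]. 1 / fact (\<delta> i * (m - 1))) *
        (Const (entry_prod T F) * foldr partial_deriv (arc_list F) ?p) = Const (?term F)"
      by (simp add: Const_mult mult_ac del: upt_Suc)
  qed
  then have "Tr m n d T = Const (of_nat (m - 1) ^ (n - 1)) *
      (\<Sum>\<delta>\<in>weak_compositions n d.
         \<Sum>F\<in>{F \<in> index_seqs m n d. row_counts n F = \<delta>}. Const (?term F))"
    unfolding Tr_def by simp
  \<comment> \<open>The fibres of \<open>row_counts\<close> partition
    \<open>index_seqs m n d\<close>.\<close>
  also have "\<dots> = Const (of_nat (m - 1) ^ (n - 1)) * (\<Sum>F\<in>index_seqs m n d. Const (?term F))"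
    using row_counts_in_weak_compositions
    by (subst sum.group) (auto simp: finite_index_seqs finite_weak_compositions)
  finally show "Tr m n d T =
      Const (of_nat (m - 1) ^ (n - 1) * (\<Sum>F\<in>index_seqs m n d. ?term F))"
    by (simp add: Const_sum [symmetric] Const_mult)
\<comment> \<open>For fixed \<open>n\<close>, all three quantities are defined from \<open>F\<close>
  through \<open>arcs F\<close> alone.\<close>
qed (simp add: arc_fact_def outdegree_fact_def closed_walks_def)

end
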